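(* Let $(Y,G,Z)$ be random variables on a common probability space with $Y,Z$ real-valued with finite first and second moments and $G\in\{0,1\}$. Define $\pi(y)=\mathbb{E}[G\mid Y=y]$ and $m(y)=\mathbb{E}[Z\mid Y=y]$ for $y$ in the support of $Y$. Suppose that: (1) $Z$ is globally calibrated, i.e. $\mathbb{E}[Y\mid Z=z]=z$ for all $z$; (2) $\pi$ is weakly monotonic (non-increasing or non-decreasing) on the support of $Y$; (3) $m$ is 1-Lipschitz, i.e. $|m(y_2)-m(y_1)|\le|y_2-y_1|$ for all $y_1,y_2$. Suppose moreover that $\delta_C(z)=0$ for all $z$ and $\delta_B(y)=0$ for all $y$. Then either $G$ and $Y$ are independent, or $\mathbb{E}[(Y-Z)^2]=0$ (i.e. $Z$ is an oracle: $Z=Y$ almost surely).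
   Context: Pointwise miscalibration within groups: $\delta_C(z)=\mathbb{E}[Y\mid Z=z,G=1]-\mathbb{E}[Y\mid Z=z,G=0]$. Pointwise imbalance across groups: $\delta_B(y)=\mathbb{E}[Z\mid Y=y,G=1]-\mathbb{E}[Z\mid Y=y,G=0]$. Conventions: $\pi$ and $m$ are versions of the conditional expectations of $G$ and $Z$ given $Y$, defined on the support of $Y$, for which (2) and (3) hold (in (3), $y_1,y_2$ range over the support of $Y$). "For all $z$" and "for all $y$" in global calibration and in the conditions on $\delta_C,\delta_B$ refer to almost every value under the law of $Z$, resp. $Y$, at which the quantities are defined; equivalently $\mathbb{E}[Y\mid Z]=Z$ a.s., $\mathbb{E}[Y\mid Z,G]=\mathbb{E}[Y\mid Z]$ a.s., and $\mathbb{E}[Z\mid Y,G]=\mathbb{E}[Z\mid Y]$ a.s. *)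

theory Defs
  imports "HOL-Probability.Probability"
begin

abbreviation sigma_of :: "'a measure \<Rightarrow> ('a \<Rightarrow> 'b::topological_space) \<Rightarrow> 'a measure" where
  "sigma_of M W \<equiv> vimage_algebra (space M) W borel"

text \<open>
  \<open>h\<close> is a version of the function \<open>w \<mapsto> E[X | W = w]\<close>, i.e. a Borel function with
  \<open>E[X | W] = h(W)\<close> almost surely. Where only the values on the support of \<open>W\<close> matter,
  the values of \<open>h\<close> elsewhere are an arbitrary Borel extension.
\<close>
definition cond_exp_version ::
    "'a measure \<Rightarrow> ('a \<Rightarrow> real) \<Rightarrow> ('a \<Rightarrow> 'b::topological_space) \<Rightarrow> ('b \<Rightarrow> real) \<Rightarrow> bool" where
  "cond_exp_version M X W h \<longleftrightarrow>
     h \<in> borel_measurable borel \<and> (AE x in M. real_cond_exp M (sigma_of M W) X x = h (W x))"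

text \<open>
  \<open>\<delta>(w) = E[X | W = w, G = 1] - E[X | W = w, G = 0]\<close>.
  With \<open>X = Y\<close>, \<open>W = Z\<close> this is the pointwise miscalibration within groups;
  with \<open>X = Z\<close>, \<open>W = Y\<close> it is the pointwise imbalance across groups.
\<close>
definition group_gap ::
    "'a measure \<Rightarrow> ('a \<Rightarrow> real) \<Rightarrow> ('a \<Rightarrow> real) \<Rightarrow> ('a \<Rightarrow> real) \<Rightarrow> (real \<Rightarrow> real) \<Rightarrow> bool" where
  "group_gap M X W G \<delta> \<longleftrightarrow>
     (\<exists>h. cond_exp_version M X (\<lambda>x. (W x, G x)) h \<and> (\<forall>w. \<delta> w = h (w, 1) - h (w, 0)))"

text \<open>
  \<open>\<delta>(w) = 0\<close> for almost every \<open>w\<close> (under the law of \<open>W\<close>) at which both conditional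
  expectations in \<open>group_gap\<close> are defined, i.e. at which both groups occur with positive
  conditional probability: \<open>0 < P(G = 1 | W = w) < 1\<close>.
  Elsewhere one of \<open>h (w, 1)\<close>, \<open>h (w, 0)\<close> is an arbitrary value of the version.
\<close>
definition gap_vanishes ::
    "'a measure \<Rightarrow> ('a \<Rightarrow> real) \<Rightarrow> ('a \<Rightarrow> real) \<Rightarrow> (real \<Rightarrow> real) \<Rightarrow> bool" where
  "gap_vanishes M W G \<delta> \<longleftrightarrow>
     (AE x in M. 0 < real_cond_exp M (sigma_of M W) G x \<and> real_cond_exp M (sigma_of M W) G x < 1
        \<longrightarrow> \<delta> (W x) = 0)"

definition law_support :: "'a measure \<Rightarrow> ('a \<Rightarrow> real) \<Rightarrow> real set" where
  "law_support M W = {w. \<forall>e>0. 0 < measure (distr M borel W) (ball w e)}"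

end

theory Submission
  imports Defs
begin

text \<open>
  Both gaps vanish, so \<open>E[G (Y - Z)] = 0 = E[G (Z - m(Y))]\<close>, and \<open>r(y) = y - m(y)\<close> satisfies
  \<open>E[r(Y)] = 0 = E[\<pi>(Y) r(Y)]\<close>. The Lipschitz condition makes \<open>r\<close> monotone on the support of
  \<open>Y\<close>, so this is the equality case of Chebyshev's covariance inequality for two monotone
  functions: either \<open>\<pi>(Y)\<close> is almost surely constant, and \<open>G\<close> is independent of \<open>Y\<close>, or
  \<open>r(Y) = 0\<close> almost surely. In the latter case \<open>E[Z | Y] = Y\<close> and \<open>E[Y | Z] = Z\<close>,
  which forces \<open>E[Y\<^sup>2] = E[Y Z] = E[Z\<^sup>2]\<close>.
\<close>

section \<open>The support of a law\<close>

text \<open>A point outside the support has a null ball and hence a null basic open set around it.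
  The reals have a countable base, so these sets together are still null. Conditions imposed on the
  support alone can therefore be used almost surely.\<close>

lemma AE_in_law_support:
  assumes "finite_measure M" and [measurable]: "W \<in> borel_measurable M"
  shows "AE x in M. W x \<in> law_support M W"
proof -
  interpret finite_measure M by fact
  obtain B :: "real set set" where B: "countable B" "topological_basis B"
    using ex_countable_basis by blast
  define N where "N = {U \<in> B. measure (distr M borel W) U = 0}"
  have "countable N"
    using B(1) by (auto simp: N_def)
  moreover have "AE x in M. W x \<notin> U" if "U \<in> N" for U
  proof -
    have U[measurable]: "U \<in> sets borel"
      using that B(2) by (auto simp: N_def topological_basis_open)
    have "measure M (W -` U \<inter> space M) = 0"
      using that by (simp add: N_def measure_distr)
    then have "W -` U \<inter> space M \<in> null_sets M"
      by (simp add: emeasure_eq_measure null_sets_def)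
    then show ?thesis
      by (rule AE_I') auto
  qed
  ultimately have "AE x in M. \<forall>U\<in>N. W x \<notin> U"
    by (simp add: AE_ball_countable)
  moreover have "\<exists>U\<in>N. w \<in> U" if "w \<notin> law_support M W" for w
  proof -
    obtain e where e: "e > 0" "measure (distr M borel W) (ball w e) = 0"
      using \<open>w \<notin> law_support M W\<close> unfolding law_support_def
      by (auto simp: not_less measure_le_0_iff)
    obtain U where U: "U \<in> B" "w \<in> U" "U \<subseteq> ball w e"
      using topological_basisE[OF B(2) open_ball, of w w e] e(1) by auto
    interpret D: finite_measure "distr M borel W"
      by (rule finite_measure_distr) simp
    have "measure (distr M borel W) U \<le> measure (distr M borel W) (ball w e)"
      using U(3) by (intro D.finite_measure_mono) auto
    with e(2) U show ?thesis
      by (auto simp: N_def measure_le_0_iff)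
  qed
  ultimately show ?thesis
    by (auto elim!: eventually_mono)
qed

section \<open>Versions of conditional expectations\<close>

lemma (in finite_measure) subalgebra_sigma_of:
  fixes W :: "'a \<Rightarrow> 'b::topological_space"
  assumes W: "W \<in> borel_measurable M"
  shows "finite_measure_subalgebra M (sigma_of M W)"
proof unfold_locales
  show "subalgebra M (sigma_of M W)"
    unfolding subalgebra_def using sets_image_in_sets[OF refl W] by simp
qed

lemma measurable_sigma_of:
  fixes W :: "'a \<Rightarrow> 'b::topological_space" and f :: "'b \<Rightarrow> real"
  assumes "f \<in> borel_measurable borel"
  shows "(\<lambda>x. f (W x)) \<in> borel_measurable (sigma_of M W)"
  using measurable_compose[OF measurable_vimage_algebra1 assms] by auto

lemma subalgebra_sigma_of_Pair:
  fixes W G :: "'a \<Rightarrow> real"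
  shows "subalgebra (sigma_of M (\<lambda>x. (W x, G x))) (sigma_of M W)"
proof -
  have "W \<in> borel_measurable (sigma_of M (\<lambda>x. (W x, G x)))"
    using measurable_sigma_of[of fst "\<lambda>x. (W x, G x)" M] by (simp add: borel_measurable_continuous_onI continuous_on_fst)
  then show ?thesis
    unfolding subalgebra_def by (simp add: sets_image_in_sets)
qed

text \<open>The defining property of conditional expectation, tested against \<open>g (W x)\<close>,
  is carried over to an arbitrary version \<open>h\<close>. The codomain of \<open>W\<close> stays
  general because pairs \<open>(W x, G x)\<close> are conditioned on as well; \<open>g = 1\<close>
  gives equality of means.\<close>

lemma (in finite_measure) cond_exp_version_integral:
  fixes W :: "'a \<Rightarrow> 'b::topological_space"
  assumes "cond_exp_version M X W h" and W[measurable]: "W \<in> borel_measurable M"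
    and [measurable]: "X \<in> borel_measurable M" "g \<in> borel_measurable borel"
    and int: "integrable M (\<lambda>x. g (W x) * X x)"
  shows "integrable M (\<lambda>x. g (W x) * h (W x))"
    and "(\<integral>x. g (W x) * h (W x) \<partial>M) = (\<integral>x. g (W x) * X x \<partial>M)"
proof -
  interpret F: finite_measure_subalgebra M "sigma_of M W"
    by (rule subalgebra_sigma_of[OF W])
  have [measurable]: "h \<in> borel_measurable borel"
    and h: "AE x in M. real_cond_exp M (sigma_of M W) X x = h (W x)"
    using assms(1) by (auto simp: cond_exp_version_def)
  have [measurable]: "real_cond_exp M (sigma_of M W) X \<in> borel_measurable M"
    using F.subalg measurable_from_subalg borel_measurable_cond_exp by blast
  have gW: "(\<lambda>x. g (W x)) \<in> borel_measurable (sigma_of M W)"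
    by (rule measurable_sigma_of) simp
  have ae: "AE x in M. g (W x) * real_cond_exp M (sigma_of M W) X x = g (W x) * h (W x)"
    using h by eventually_elim simp
  note R = F.real_cond_exp_intg[OF int gW \<open>X \<in> borel_measurable M\<close>]
  show "integrable M (\<lambda>x. g (W x) * h (W x))"
    using R(1) by (rule integrable_cong_AE_imp) (simp, rule ae)
  show "(\<integral>x. g (W x) * h (W x) \<partial>M) = (\<integral>x. g (W x) * X x \<partial>M)"
    using R(2) integral_cong_AE[OF _ _ ae] by simp
qed

section \<open>Expectations weighted by the group\<close>

text \<open>By the tower property \<open>c (W x)\<close> is a mixture of \<open>h (W x, 1)\<close>
  and \<open>h (W x, 0)\<close> with weights \<open>p x\<close> and \<open>1 - p x\<close>, where
  \<open>p\<close> is the conditional probability of \<open>G = 1\<close> given \<open>W\<close>.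
  The vanishing gap makes \<open>c\<close> and \<open>h (_, 1)\<close> agree almost surely once
  multiplied by \<open>p\<close>, and under the integral \<open>p\<close> and \<open>G\<close> are
  interchangeable.\<close>

lemma (in prob_space) integral_group_of_gap_vanishes:
  fixes X W G :: "'a \<Rightarrow> real"
  assumes [measurable]: "X \<in> borel_measurable M" "W \<in> borel_measurable M" "G \<in> borel_measurable M"
    and X: "integrable M X" and G: "\<And>x. x \<in> space M \<Longrightarrow> G x \<in> {0, 1}"
    and c: "cond_exp_version M X W c"
    and gap: "group_gap M X W G \<delta>" and van: "gap_vanishes M W G \<delta>"
  shows "integrable M (\<lambda>x. G x * c (W x))"
    and "(\<integral>x. G x * c (W x) \<partial>M) = (\<integral>x. G x * X x \<partial>M)"
proof -
  let ?F = "sigma_of M W" and ?H = "sigma_of M (\<lambda>x. (W x, G x))"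
  interpret F: finite_measure_subalgebra M ?F
    by (rule subalgebra_sigma_of) simp
  interpret H: finite_measure_subalgebra M ?H
    by (rule subalgebra_sigma_of) simp
  obtain h where h: "cond_exp_version M X (\<lambda>x. (W x, G x)) h"
    and \<delta>: "\<And>w. \<delta> w = h (w, 1) - h (w, 0)"
    using gap by (auto simp: group_gap_def)
  have [measurable]: "h \<in> borel_measurable borel" "c \<in> borel_measurable borel"
    and hX: "AE x in M. real_cond_exp M ?H X x = h (W x, G x)"
    and cX: "AE x in M. real_cond_exp M ?F X x = c (W x)"
    using h c by (auto simp: cond_exp_version_def)
  have hm[measurable]: "(\<lambda>w. h (w, g)) \<in> borel_measurable borel" for g
    by (rule measurable_compose[where g = h and N = borel])
      (auto intro!: borel_measurable_continuous_onI continuous_intros)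
  have Gb: "AE x in M. norm (G x) \<le> 1"
    by (rule AE_I2) (use G in fastforce)
  have intG: "integrable M G"
    using Gb by (intro integrable_const_bound[of G 1]) auto
  \<comment> \<open>\<open>G\<close> takes only the values 0 and 1, so \<open>g (G x)\<close> is
    bounded by the larger of its two absolute values.\<close>
  have intM: "integrable M (\<lambda>x. g (G x) * f x)"
    if [measurable]: "g \<in> borel_measurable borel" and f: "integrable M f" for f and g :: "real \<Rightarrow> real"
  proof (rule Bochner_Integration.integrable_bound[OF integrable_mult_right[OF f]])
    have [measurable]: "f \<in> borel_measurable M"
      using f by simp
    show "(\<lambda>x. g (G x) * f x) \<in> borel_measurable M"
      by simp
    show "AE x in M. norm (g (G x) * f x) \<le> norm (max \<bar>g 0\<bar> \<bar>g 1\<bar> * f x)"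
      by (rule AE_I2) (use G in \<open>fastforce simp: abs_mult intro!: mult_right_mono\<close>)
  qed
  have inth: "integrable M (\<lambda>x. h (W x, G x))"
    using cond_exp_version_integral(1)[OF h, of "\<lambda>_. 1"] X by simp
  \<comment> \<open>Where \<open>G = 1\<close> has conditional probability 0,
    \<open>h (w, 1)\<close> is arbitrary, so \<open>h (W x, 1)\<close> alone need not be integrable.
    The factor \<open>G x\<close> makes the product equal to \<open>G x * h (W x, G x)\<close>,
    which is.\<close>
  have int1: "integrable M (\<lambda>x. h (W x, 1) * G x)"
    using intM[of "\<lambda>g. g", OF _ inth]
    by (rule integrable_cong_AE_imp) (use G in \<open>fastforce intro!: AE_I2\<close>)+
  have int0: "integrable M (\<lambda>x. h (W x, 0) * (1 - G x))"
    using intM[of "\<lambda>g. 1 - g", OF _ inth]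
    by (rule integrable_cong_AE_imp) (use G in \<open>fastforce intro!: AE_I2\<close>)+
  have intc: "integrable M (\<lambda>x. c (W x))"
    using cond_exp_version_integral(1)[OF c, of "\<lambda>_. 1"] X by simp
  show intGc: "integrable M (\<lambda>x. G x * c (W x))"
    using intM[of "\<lambda>g. g", OF _ intc] by simp
  define p where "p = real_cond_exp M ?F G"
  have [measurable]: "p \<in> borel_measurable M"
    unfolding p_def using F.subalg measurable_from_subalg borel_measurable_cond_exp by blast
  have p0: "AE x in M. 0 \<le> p x"
    unfolding p_def by (rule F.real_cond_exp_ge_c) (use intG G in \<open>fastforce intro!: AE_I2\<close>)+
  have p1: "AE x in M. p x \<le> 1"
    unfolding p_def by (rule F.real_cond_exp_le_c) (use intG G in \<open>fastforce intro!: AE_I2\<close>)+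
  have "AE x in M. c (W x) = h (W x, 1) * p x + h (W x, 0) * (1 - p x)"
  proof -
    have 1: "AE x in M. real_cond_exp M ?F (real_cond_exp M ?H X) x = real_cond_exp M ?F X x"
      by (rule F.real_cond_exp_nested_subalg[OF H.subalg subalgebra_sigma_of_Pair X])
    have "AE x in M. real_cond_exp M ?H X x = h (W x, 1) * G x + h (W x, 0) * (1 - G x)"
      using hX AE_space by eventually_elim (use G in fastforce)
    then have 2: "AE x in M. real_cond_exp M ?F (real_cond_exp M ?H X) x
        = real_cond_exp M ?F (\<lambda>x. h (W x, 1) * G x + h (W x, 0) * (1 - G x)) x"
      by (rule F.real_cond_exp_cong)
        (use H.subalg measurable_from_subalg borel_measurable_cond_exp in blast, simp)
    have 3: "AE x in M. real_cond_exp M ?F (\<lambda>x. h (W x, 1) * G x + h (W x, 0) * (1 - G x)) x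
        = real_cond_exp M ?F (\<lambda>x. h (W x, 1) * G x) x
          + real_cond_exp M ?F (\<lambda>x. h (W x, 0) * (1 - G x)) x"
      by (rule F.real_cond_exp_add[OF int1 int0])
    have 4: "AE x in M. real_cond_exp M ?F (\<lambda>x. h (W x, 1) * G x) x = h (W x, 1) * p x"
      unfolding p_def by (rule F.real_cond_exp_mult[OF measurable_sigma_of[OF hm] _ int1]) simp
    have 5: "AE x in M. real_cond_exp M ?F (\<lambda>x. h (W x, 0) * (1 - G x)) x
        = h (W x, 0) * real_cond_exp M ?F (\<lambda>x. 1 - G x) x"
      by (rule F.real_cond_exp_mult[OF measurable_sigma_of[OF hm] _ int0]) simp
    have 6: "AE x in M. real_cond_exp M ?F (\<lambda>x. 1 - G x) x = real_cond_exp M ?F (\<lambda>x. 1) x - p x"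
      unfolding p_def by (rule F.real_cond_exp_diff) (use intG in auto)
    have 7: "AE x in M. real_cond_exp M ?F (\<lambda>x. 1) x = 1"
      by (rule F.real_cond_exp_F_meas) auto
    show ?thesis
      using cX 1 2 3 4 5 6 7 by eventually_elim simp
  qed
  moreover have "AE x in M. 0 < p x \<and> p x < 1 \<longrightarrow> \<delta> (W x) = 0"
    using van unfolding gap_vanishes_def p_def .
  \<comment> \<open>For \<open>p x = 0\<close> both sides vanish; for \<open>p x = 1\<close> the
    mixture is just \<open>h (W x, 1)\<close>; in between, the zero gap equates its two
    components.\<close>
  ultimately have ae: "AE x in M. c (W x) * p x = h (W x, 1) * p x"
    using p0 p1
  proof eventually_elim
    case (elim x)
    consider "p x = 0" | "p x = 1" | "0 < p x" "p x < 1"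
      using elim by linarith
    then show ?case
      using elim by cases (auto simp: \<delta> algebra_simps)
  qed
  have "(\<integral>x. G x * c (W x) \<partial>M) = (\<integral>x. c (W x) * G x \<partial>M)"
    by (simp add: mult.commute)
  also have "\<dots> = (\<integral>x. c (W x) * p x \<partial>M)"
    unfolding p_def
    by (rule F.real_cond_exp_intg(2)[symmetric, OF _ measurable_sigma_of])
      (use intGc in \<open>simp_all add: mult.commute\<close>)
  also have "\<dots> = (\<integral>x. h (W x, 1) * p x \<partial>M)"
    by (rule integral_cong_AE) (use ae in auto)
  also have "\<dots> = (\<integral>x. h (W x, 1) * G x \<partial>M)"
    unfolding p_def by (rule F.real_cond_exp_intg(2)[OF int1 measurable_sigma_of[OF hm]]) simp
  \<comment> \<open>Now \<open>h\<close> is evaluated at the actual pair, so its defining property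
    applies with the second projection as test function.\<close>
  also have "\<dots> = (\<integral>x. G x * h (W x, G x) \<partial>M)"
    by (rule Bochner_Integration.integral_cong) (use G in fastforce)+
  also have "\<dots> = (\<integral>x. G x * X x \<partial>M)"
    using cond_exp_version_integral(2)[OF h, of snd] intM[of "\<lambda>g. g", OF _ X]
    by (simp add: borel_measurable_continuous_onI continuous_on_snd)
  finally show "(\<integral>x. G x * c (W x) \<partial>M) = (\<integral>x. G x * X x \<partial>M)" .
qed

section \<open>Equality in Chebyshev's covariance inequality\<close>

text \<open>
  With \<open>k\<close> the supremum of \<open>f\<close> over \<open>{r < 0}\<close>, the product \<open>(f - k) r\<close> is nonnegative, so
  it vanishes almost surely; by monotonicity \<open>f = k\<close> then also holds where \<open>r = 0\<close>.
\<close>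
lemma (in prob_space) uncorrelated_mono_on:
  fixes f r :: "real \<Rightarrow> real"
  assumes S: "AE x in M. Y x \<in> S" and f: "mono_on S f" and r: "mono_on S r"
    and intr: "integrable M (\<lambda>x. r (Y x))" and intfr: "integrable M (\<lambda>x. f (Y x) * r (Y x))"
    and r0: "(\<integral>x. r (Y x) \<partial>M) = 0" and fr0: "(\<integral>x. f (Y x) * r (Y x) \<partial>M) = 0"
  shows "(AE x in M. r (Y x) = 0) \<or> (\<exists>k. AE x in M. f (Y x) = k)"
proof (rule disjCI)
  assume const: "\<nexists>k. AE x in M. f (Y x) = k"
  define L where "L = {y \<in> S. r y < 0}"
  define U where "U = {y \<in> S. r y > 0}"
  \<comment> \<open>The signs of \<open>r\<close> and its monotonicity force \<open>a < b\<close>,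
    and then \<open>f\<close> is compared.\<close>
  have below: "f a \<le> f b" if "a \<in> L" "b \<in> U" for a b
    using that mono_onD[OF r, of b a] mono_onD[OF f, of a b] by (force simp: L_def U_def)
  have one_sign: "AE x in M. r (Y x) = 0"
    if "(AE x in M. 0 \<le> r (Y x)) \<or> (AE x in M. 0 \<le> - r (Y x))"
    using that
  proof
    assume "AE x in M. 0 \<le> r (Y x)"
    then show ?thesis
      using integral_nonneg_eq_0_iff_AE[OF intr] r0 by simp
  next
    assume "AE x in M. 0 \<le> - r (Y x)"
    then show ?thesis
      using integral_nonneg_eq_0_iff_AE[OF integrable_minus[OF intr]] r0 by simp
  qed
  show "AE x in M. r (Y x) = 0"
  proof (cases "L = {} \<or> U = {}")
    case True
    then have "(AE x in M. 0 \<le> r (Y x)) \<or> (AE x in M. 0 \<le> - r (Y x))"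
    proof
      assume "L = {}"
      then have "AE x in M. 0 \<le> r (Y x)"
        using S by (auto simp: L_def not_less elim!: eventually_mono)
      then show ?thesis ..
    next
      assume "U = {}"
      then have "AE x in M. 0 \<le> - r (Y x)"
        using S by (auto simp: U_def not_less elim!: eventually_mono)
      then show ?thesis ..
    qed
    then show ?thesis
      by (rule one_sign)
  next
    case False
    then obtain a b where ab: "a \<in> L" "b \<in> U"
      by auto
    \<comment> \<open>An element of \<open>U\<close> bounds \<open>f\<close> on \<open>L\<close>,
      and \<open>L\<close> is nonempty, so this is a genuine supremum. Every value of
      \<open>f\<close> on \<open>U\<close> is an upper bound too, hence \<open>k\<close> separates
      the two images.\<close>
    define k where "k = Sup (f ` L)"
    have bdd: "bdd_above (f ` L)"
      using below[OF _ ab(2)] by (auto intro!: bdd_aboveI[of _ "f b"])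
    have kL: "f y \<le> k" if "y \<in> L" for y
      unfolding k_def using that bdd by (intro cSUP_upper)
    have kU: "k \<le> f y" if "y \<in> U" for y
      unfolding k_def using that ab(1) below by (intro cSUP_least) auto
    have "0 \<le> (f y - k) * r y" if "y \<in> S" for y
      using that kL[of y] kU[of y]
      by (cases "r y" "0 :: real" rule: linorder_cases)
        (auto simp: L_def U_def mult_nonpos_nonpos)
    then have "AE x in M. 0 \<le> f (Y x) * r (Y x) - k * r (Y x)"
      using S by (auto simp: left_diff_distrib elim!: eventually_mono)
    then have ae: "AE x in M. f (Y x) * r (Y x) - k * r (Y x) = 0"
      using integral_nonneg_eq_0_iff_AE[of M "\<lambda>x. f (Y x) * r (Y x) - k * r (Y x)"]
        intr intfr r0 fr0 by simp
    have eq: "AE x in M. r (Y x) = 0 \<or> f (Y x) = k"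
      using ae by eventually_elim (auto simp flip: left_diff_distrib)
    show ?thesis
    proof (cases "(AE x in M. 0 \<le> r (Y x)) \<or> (AE x in M. 0 \<le> - r (Y x))")
      case True
      then show ?thesis
        by (rule one_sign)
    next
      case False
      \<comment> \<open>On \<open>L\<close> only \<open>f = k\<close> is compatible with
        \<open>eq\<close>. If \<open>k\<close> were not attained there, \<open>Y\<close> would
        almost surely avoid \<open>L\<close>, and \<open>r\<close> would have one sign. The same
        argument applies to \<open>U\<close>.\<close>
      have "\<exists>y\<in>L. f y = k"
      proof (rule ccontr)
        assume "\<not> ?thesis"
        then have "0 \<le> r y" if "y \<in> S" "r y = 0 \<or> f y = k" for y
          using that by (cases "r y < 0") (auto simp: L_def)
        then have "AE x in M. 0 \<le> r (Y x)"
          using eq S by (auto elim!: eventually_elim2)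
        with False show False by simp
      qed
      then obtain a where a: "a \<in> L" "f a = k" by auto
      have "\<exists>y\<in>U. f y = k"
      proof (rule ccontr)
        assume "\<not> ?thesis"
        then have "0 \<le> - r y" if "y \<in> S" "r y = 0 \<or> f y = k" for y
          using that by (cases "r y > 0") (auto simp: U_def)
        then have "AE x in M. 0 \<le> - r (Y x)"
          using eq S by (auto elim!: eventually_elim2)
        with False show False by simp
      qed
      then obtain b where b: "b \<in> U" "f b = k" by auto
      have "AE x in M. f (Y x) = k"
        using eq S
      proof eventually_elim
        case (elim x)
        show ?case
        proof (cases "r (Y x) = 0")
          case True
          \<comment> \<open>Since \<open>r a < 0 < r b\<close>, monotonicity traps every zero of
            \<open>r\<close> in the support set \<open>S\<close> between \<open>a\<close> and
            \<open>b\<close>, where \<open>f\<close> is squeezed between two values equal to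
            \<open>k\<close>.\<close>
          have "a \<le> Y x" "Y x \<le> b"
            using mono_onD[OF r, of "Y x" a] mono_onD[OF r, of b "Y x"] a b True elim
            by (force simp: L_def U_def)+
          then show ?thesis
            using mono_onD[OF f, of a "Y x"] mono_onD[OF f, of "Y x" b] a b elim
            by (auto simp: L_def U_def)
        qed (use elim in simp)
      qed
      with const show ?thesis by blast
    qed
  qed
qed

section \<open>The two alternatives of the conclusion\<close>

text \<open>For binary \<open>G\<close>, joint probabilities with \<open>Y\<close> depend only on
  the integrals of \<open>G\<close> over events \<open>Y x \<in> B\<close>, and these equal
  \<open>k\<close> times the probability of the event. The joint law thus factors, and
  \<open>B = UNIV\<close> identifies the other factor as the law of \<open>G\<close>.\<close>

lemma (in prob_space) indep_var_of_cond_exp_const: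
  fixes Y G :: "'a \<Rightarrow> real"
  assumes [measurable]: "Y \<in> borel_measurable M" "G \<in> borel_measurable M"
    and G: "\<And>x. x \<in> space M \<Longrightarrow> G x \<in> {0, 1}"
    and \<pi>: "cond_exp_version M G Y \<pi>" and k: "AE x in M. \<pi> (Y x) = k"
  shows "indep_var borel G borel Y"
proof -
  have [measurable]: "\<pi> \<in> borel_measurable borel"
    using \<pi> by (simp add: cond_exp_version_def)
  have Gb: "AE x in M. norm (indicator B (Y x) * G x) \<le> 1" for B
    by (rule AE_I2) (use G in \<open>force simp: indicator_def\<close>)
  have int: "integrable M (\<lambda>x. indicator B (Y x) * G x)" if [measurable]: "B \<in> sets borel" for B
    using Gb by (intro integrable_const_bound[where B = 1]) auto
  have GB: "(\<integral>x. indicator B (Y x) * G x \<partial>M) = k * prob (Y -` B \<inter> space M)"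
    if B[measurable]: "B \<in> sets borel" for B
  proof -
    have "(\<integral>x. indicator B (Y x) * G x \<partial>M) = (\<integral>x. indicator B (Y x) * \<pi> (Y x) \<partial>M)"
      using cond_exp_version_integral(2)[OF \<pi> _ _ _ int[OF B]] by simp
    also have "\<dots> = (\<integral>x. k * indicator (Y -` B \<inter> space M) x \<partial>M)"
    proof (rule integral_cong_AE)
      show "AE x in M. indicator B (Y x) * \<pi> (Y x) = k * indicator (Y -` B \<inter> space M) x"
        using k AE_space by eventually_elim (simp add: indicator_def)
    qed simp_all
    finally show ?thesis by simp
  qed
  have joint: "prob ((G -` A \<inter> space M) \<inter> (Y -` B \<inter> space M))
      = (indicator A 0 + (indicator A 1 - indicator A 0) * k) * prob (Y -` B \<inter> space M)"
    if [measurable]: "A \<in> sets borel" "B \<in> sets borel" for A B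
  proof -
    have "prob ((G -` A \<inter> space M) \<inter> (Y -` B \<inter> space M))
        = (\<integral>x. indicator ((G -` A \<inter> space M) \<inter> (Y -` B \<inter> space M)) x \<partial>M)"
      by simp
    \<comment> \<open>On {0, 1} every function of \<open>G\<close> is affine in
      \<open>G\<close>.\<close>
    also have "\<dots> = (\<integral>x. indicator A 0 * indicator (Y -` B \<inter> space M) x
        + (indicator A 1 - indicator A 0) * (indicator B (Y x) * G x) \<partial>M)"
      by (rule Bochner_Integration.integral_cong) (use G in \<open>force simp: indicator_def\<close>)+
    also have "\<dots> = indicator A 0 * prob (Y -` B \<inter> space M)
        + (indicator A 1 - indicator A 0) * (\<integral>x. indicator B (Y x) * G x \<partial>M)"
      by (subst Bochner_Integration.integral_add) (use int in \<open>auto simp: emeasure_eq_measure\<close>)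
    finally show ?thesis
      by (simp add: GB[OF that(2)] distrib_right)
  qed
  have marg: "prob (G -` A \<inter> space M) = indicator A 0 + (indicator A 1 - indicator A 0) * k"
    if "A \<in> sets borel" for A
    using joint[OF that, of UNIV] by (simp add: prob_space Int_absorb2)
  \<comment> \<open>Preimages of Borel sets already form a sigma-algebra, so the product rule need
    only be checked on them.\<close>
  have sig: "sigma_sets (space M) {W -` A \<inter> space M |A. A \<in> sets borel}
      = {W -` A \<inter> space M |A. A \<in> sets borel}" for W :: "'a \<Rightarrow> real"
    using sets_vimage_algebra2[of W "space M" borel] by (simp add: sets_vimage_algebra)
  show ?thesis
    unfolding indep_var_eq sig
  proof (intro conjI indep_setI)
    fix a b
    assume "a \<in> {G -` A \<inter> space M |A. A \<in> sets borel}" "b \<in> {Y -` A \<inter> space M |A. A \<in> sets borel}"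
    then obtain A B where "A \<in> sets borel" "B \<in> sets borel"
      and "a = G -` A \<inter> space M" "b = Y -` B \<inter> space M"
      by blast
    then show "prob (a \<inter> b) = prob a * prob b"
      by (simp only: joint marg)
  qed (use assms(1,2) in \<open>blast intro: measurable_sets\<close>)+
qed

text \<open>The mixed moment is computed twice: conditioning on \<open>Y\<close> gives the second
  moment of \<open>Y\<close>, conditioning on \<open>Z\<close> that of \<open>Z\<close>. Expanding
  the square then leaves 0.\<close>

lemma (in prob_space) expectation_square_diff_eq_0:
  fixes Y Z :: "'a \<Rightarrow> real"
  assumes [measurable]: "Y \<in> borel_measurable M" "Z \<in> borel_measurable M"
    and Y2: "integrable M (\<lambda>x. (Y x)\<^sup>2)" and Z2: "integrable M (\<lambda>x. (Z x)\<^sup>2)"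
    and ZY: "cond_exp_version M Z Y m" and YZ: "cond_exp_version M Y Z (\<lambda>z. z)"
    and m: "AE x in M. Y x - m (Y x) = 0"
  shows "expectation (\<lambda>x. (Y x - Z x)\<^sup>2) = 0"
proof -
  have [measurable]: "m \<in> borel_measurable borel"
    using ZY by (simp add: cond_exp_version_def)
  have int: "integrable M (\<lambda>x. Y x * Z x)"
  proof (rule Bochner_Integration.integrable_bound[OF Bochner_Integration.integrable_add[OF Y2 Z2]])
    show "AE x in M. norm (Y x * Z x) \<le> norm ((Y x)\<^sup>2 + (Z x)\<^sup>2)"
    proof (rule AE_I2)
      fix x
      show "norm (Y x * Z x) \<le> norm ((Y x)\<^sup>2 + (Z x)\<^sup>2)"
        using sum_squares_bound[of "\<bar>Y x\<bar>" "\<bar>Z x\<bar>"]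
          mult_nonneg_nonneg[OF abs_ge_zero[of "Y x"] abs_ge_zero[of "Z x"]]
        unfolding real_norm_def abs_mult power2_abs by linarith
    qed
  qed simp
  have "(\<integral>x. Y x * Z x \<partial>M) = (\<integral>x. Y x * m (Y x) \<partial>M)"
    by (rule cond_exp_version_integral(2)[symmetric, OF ZY _ _ _ int]) simp_all
  also have "\<dots> = (\<integral>x. (Y x)\<^sup>2 \<partial>M)"
  proof (rule integral_cong_AE)
    show "AE x in M. Y x * m (Y x) = (Y x)\<^sup>2"
      using m by eventually_elim (simp add: power2_eq_square)
  qed simp_all
  finally have 1: "(\<integral>x. Y x * Z x \<partial>M) = (\<integral>x. (Y x)\<^sup>2 \<partial>M)" .
  have "(\<integral>x. Z x * Z x \<partial>M) = (\<integral>x. Z x * Y x \<partial>M)"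
    by (rule cond_exp_version_integral(2)[OF YZ]) (use int in \<open>simp_all add: mult.commute\<close>)
  then have 2: "(\<integral>x. Y x * Z x \<partial>M) = (\<integral>x. (Z x)\<^sup>2 \<partial>M)"
    by (simp add: power2_eq_square mult.commute)
  have "expectation (\<lambda>x. (Y x - Z x)\<^sup>2) = expectation (\<lambda>x. (Y x)\<^sup>2 + (Z x)\<^sup>2 - 2 * (Y x * Z x))"
    by (simp add: power2_diff mult.assoc)
  also have "\<dots> = (\<integral>x. (Y x)\<^sup>2 \<partial>M) + (\<integral>x. (Z x)\<^sup>2 \<partial>M) - 2 * (\<integral>x. Y x * Z x \<partial>M)"
    using Y2 Z2 int by simp
  finally show ?thesis
    using 1 2 by simp
qed

section \<open>Reduction to uncorrelated monotone functions\<close>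

theorem proposition5:
  fixes M :: "'a measure"
    and Y Z G :: "'a \<Rightarrow> real"
    and \<pi> m \<delta>C \<delta>B :: "real \<Rightarrow> real"
  assumes "prob_space M"
    and "Y \<in> borel_measurable M" and "Z \<in> borel_measurable M" and "G \<in> borel_measurable M"
    and "integrable M Y" and "integrable M (\<lambda>x. (Y x)\<^sup>2)"
    and "integrable M Z" and "integrable M (\<lambda>x. (Z x)\<^sup>2)"
    and "\<And>x. x \<in> space M \<Longrightarrow> G x \<in> {0, 1}"
    and "cond_exp_version M G Y \<pi>"
    and "cond_exp_version M Z Y m"
    and "cond_exp_version M Y Z (\<lambda>z. z)"
    and "mono_on (law_support M Y) \<pi> \<or> antimono_on (law_support M Y) \<pi>"
    and "\<forall>y1\<in>law_support M Y. \<forall>y2\<in>law_support M Y. \<bar>m y2 - m y1\<bar> \<le> \<bar>y2 - y1\<bar>"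
    and "group_gap M Y Z G \<delta>C" and "gap_vanishes M Z G \<delta>C"
    and "group_gap M Z Y G \<delta>B" and "gap_vanishes M Y G \<delta>B"
  shows "prob_space.indep_var M borel G borel Y
       \<or> prob_space.expectation M (\<lambda>x. (Y x - Z x)\<^sup>2) = 0"
proof -
  interpret prob_space M by fact
  note [measurable] = assms(2-4)
  have [measurable]: "\<pi> \<in> borel_measurable borel" "m \<in> borel_measurable borel"
    using assms(10,11) by (auto simp: cond_exp_version_def)
  let ?S = "law_support M Y"
  define r where "r y = y - m y" for y
  have [measurable]: "r \<in> borel_measurable borel"
    unfolding r_def by simp
  have S: "AE x in M. Y x \<in> ?S"
    by (rule AE_in_law_support[OF _ assms(2)]) unfold_locales
  have intm: "integrable M (\<lambda>x. m (Y x))"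
    and "(\<integral>x. m (Y x) \<partial>M) = expectation Z"
    using cond_exp_version_integral[OF assms(11,2,3), of "\<lambda>_. 1"] assms(7) by simp_all
  moreover have "expectation Z = expectation Y"
    using cond_exp_version_integral(2)[OF assms(12,3,2), of "\<lambda>_. 1"] assms(5) by simp
  ultimately have r0: "(\<integral>x. r (Y x) \<partial>M) = 0" and intr: "integrable M (\<lambda>x. r (Y x))"
    using assms(5) by (simp_all add: r_def)
  \<comment> \<open>\<open>C\<close> equates the integrals of \<open>G x * Z x\<close> and
    \<open>G x * Y x\<close>, while \<open>B\<close> equates those of \<open>G x * m (Y x)\<close>
    and \<open>G x * Z x\<close>. Together they make \<open>r (Y x) * G x\<close> integrate to
    0.\<close>
  note C = integral_group_of_gap_vanishes[OF assms(2-5,9,12,15,16)]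
  note B = integral_group_of_gap_vanishes[OF assms(3,2,4,7,9,11,17,18)]
  have intGY: "integrable M (\<lambda>x. G x * Y x)"
  proof (rule Bochner_Integration.integrable_bound[OF assms(5)])
    show "AE x in M. norm (G x * Y x) \<le> norm (Y x)"
      by (rule AE_I2) (use assms(9) in fastforce)
  qed simp
  have intGr: "integrable M (\<lambda>x. r (Y x) * G x)" and Gr0: "(\<integral>x. r (Y x) * G x \<partial>M) = 0"
    using intGY B C by (simp_all add: r_def algebra_simps)
  \<comment> \<open>With \<open>r\<close> as test function, \<open>G\<close> is replaced by
    \<open>\<pi> (Y x)\<close>, leaving two functions of \<open>Y\<close> alone.\<close>
  note I = cond_exp_version_integral[OF assms(10) assms(2,4) \<open>r \<in> _\<close> intGr]
  have int\<pi>r: "integrable M (\<lambda>x. \<pi> (Y x) * r (Y x))"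
    and \<pi>r0: "(\<integral>x. \<pi> (Y x) * r (Y x) \<partial>M) = 0"
    using I Gr0 by (simp_all add: mult.commute)
  have r: "mono_on ?S r"
  proof (rule mono_onI)
    fix a b assume "a \<in> ?S" "b \<in> ?S" "a \<le> b"
    then have "\<bar>m b - m a\<bar> \<le> \<bar>b - a\<bar>"
      using assms(14) by blast
    with \<open>a \<le> b\<close> show "r a \<le> r b"
      unfolding r_def by linarith
  qed
  have "(AE x in M. r (Y x) = 0) \<or> (\<exists>k. AE x in M. \<pi> (Y x) = k)"
    using assms(13)
  proof
    assume "mono_on ?S \<pi>"
    then show ?thesis
      by (rule uncorrelated_mono_on[OF S _ r intr int\<pi>r r0 \<pi>r0])
  next
    assume "antimono_on ?S \<pi>"
    then have "mono_on ?S (\<lambda>y. - \<pi> y)"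
      by (simp add: monotone_on_def)
    then have "(AE x in M. r (Y x) = 0) \<or> (\<exists>k. AE x in M. - \<pi> (Y x) = k)"
      by (rule uncorrelated_mono_on[OF S _ r intr _ r0]) (use int\<pi>r \<pi>r0 in simp_all)
    moreover have "- \<pi> y = k \<longleftrightarrow> \<pi> y = - k" for y k
      by linarith
    ultimately show ?thesis
      by simp blast
  qed
  then show ?thesis
  proof
    assume "AE x in M. r (Y x) = 0"
    then show ?thesis
      unfolding r_def
      using expectation_square_diff_eq_0[OF assms(2,3,6,8,11,12)] by blast
  next
    assume "\<exists>k. AE x in M. \<pi> (Y x) = k"
    then show ?thesis
      using indep_var_of_cond_exp_const[OF assms(2,4,9,10)] by blast
  qed
qed

end
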